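(* Suppose $n$ units are partitioned into $b$ blocks, block $c$ having $n_c\ge r$ units, with fixed potential outcomes $y_{kcs}\in\mathbb{R}$. Under balanced block randomization, for any treatments $s$ and $t$ with $s\neq t$: $$\mathbb{E}(\hat\delta_{st,\mathrm{diff}})=\delta_{st},$$ $$\mathrm{Var}(\hat\delta_{st,\mathrm{diff}})=\sum_{c=1}^b\frac{n_c^2}{n^2}\left(\frac{r-1}{n_c-1}(\sigma_{cs}^2+\sigma_{ct}^2)+2\frac{\gamma_{cst}}{n_c-1}\right)+\sum_{c=1}^b\frac{n_c^2}{n^2}\left(\frac{rz_c(r-z_c)}{(n_c-1)(n_c-z_c)(n_c+r-z_c)}(\sigma_{cs}^2+\sigma_{ct}^2)\right).$$
   Context: There are $n$ units and $r$ treatments; each unit is assigned exactly one treatment. The units are partitioned into blocks $c=1,\dots,b$; block $c$ has $n_c$ units, $(k,c)$ denotes the $k$-th unit of block $c$ ($1\le k\le n_c$), and $z_c$ is the remainder of $n_c$ divided by $r$ ($0\le z_c<r$). Balanced block randomization means: independently across blocks, the treatment assignment within block $c$ is drawn uniformly at random from all balanced assignments of that block, i.e. assignments in which exactly $z_c$ of the treatments are each given to $\lfloor n_c/r\rfloor+1$ units and the other $r-z_c$ treatments are each given to $\lfloor n_c/r\rfloor$ units. $T_{kcs}$ is the indicator that unit $(k,c)$ receives treatment $s$, and $\#T_{cs}=\sum_{k=1}^{n_c}T_{kcs}$ (which is $\ge1$). The potential outcome $y_{kcs}$ of unit $(k,c)$ under treatment $s$ is non-random. Define the block-level parameters $$\mu_{cs}=\frac1{n_c}\sum_{k=1}^{n_c}y_{kcs},\quad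 \sigma_{cs}^2=\frac1{n_c}\sum_{k=1}^{n_c}(y_{kcs}-\mu_{cs})^2,\quad \gamma_{cst}=\frac1{n_c}\sum_{k=1}^{n_c}(y_{kcs}-\mu_{cs})(y_{kct}-\mu_{ct}),$$ the sample average treatment effect of $s$ relative to $t$ $$\delta_{st}=\frac1n\sum_{c=1}^b\sum_{k=1}^{n_c}(y_{kcs}-y_{kct}),$$ and the difference-in-means estimator $$\hat\delta_{st,\mathrm{diff}}=\sum_{c=1}^b\frac{n_c}{n}\sum_{k=1}^{n_c}\left(\frac{y_{kcs}T_{kcs}}{\#T_{cs}}-\frac{y_{kct}T_{kct}}{\#T_{ct}}\right).$$ *)

theory Defs
  imports "HOL-Probability.Probability"
begin

text \<open>
  Treatments are \<open>1, \<dots>, r\<close>, blocks are \<open>1, \<dots>, b\<close>, and the units of a block of size \<open>m\<close>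
  are \<open>1, \<dots>, m\<close>. Block sizes are given by \<open>nc\<close>, and \<open>y k c s\<close> is the potential outcome of
  unit \<open>(k, c)\<close> under treatment \<open>s\<close>. An assignment \<open>W\<close> gives unit \<open>(k, c)\<close> the treatment
  \<open>W c k\<close>, so each unit receives exactly one treatment.
\<close>

definition balanced_assignments :: "nat \<Rightarrow> nat \<Rightarrow> (nat \<Rightarrow> nat) set" where
  "balanced_assignments r m =
    {f \<in> {1..m} \<rightarrow>\<^sub>E {1..r}. \<exists>Z \<subseteq> {1..r}. card Z = m mod r \<and>
       (\<forall>s\<in>Z. card {k \<in> {1..m}. f k = s} = m div r + 1) \<and>
       (\<forall>s\<in>{1..r} - Z. card {k \<in> {1..m}. f k = s} = m div r)}"

text \<open>
  The product distribution makes the block assignments independent. The set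
  \<open>balanced_assignments r m\<close> is finite, and nonempty whenever \<open>r > 0\<close>, so that
  \<open>pmf_of_set\<close> is the uniform distribution on it.
\<close>

definition balanced_block_randomization ::
    "nat \<Rightarrow> nat \<Rightarrow> (nat \<Rightarrow> nat) \<Rightarrow> (nat \<Rightarrow> nat \<Rightarrow> nat) pmf" where
  "balanced_block_randomization r b nc =
    Pi_pmf {1..b} undefined (\<lambda>c. pmf_of_set (balanced_assignments r (nc c)))"

definition treat :: "(nat \<Rightarrow> nat \<Rightarrow> nat) \<Rightarrow> nat \<Rightarrow> nat \<Rightarrow> nat \<Rightarrow> real" where
  "treat W k c s = (if W c k = s then 1 else 0)"

definition num_treated ::
    "(nat \<Rightarrow> nat) \<Rightarrow> (nat \<Rightarrow> nat \<Rightarrow> nat) \<Rightarrow> nat \<Rightarrow> nat \<Rightarrow> real" where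
  "num_treated nc W c s = (\<Sum>k=1..nc c. treat W k c s)"

definition block_mean ::
    "(nat \<Rightarrow> nat) \<Rightarrow> (nat \<Rightarrow> nat \<Rightarrow> nat \<Rightarrow> real) \<Rightarrow> nat \<Rightarrow> nat \<Rightarrow> real" where
  "block_mean nc y c s = 1 / real (nc c) * (\<Sum>k=1..nc c. y k c s)"

definition block_var ::
    "(nat \<Rightarrow> nat) \<Rightarrow> (nat \<Rightarrow> nat \<Rightarrow> nat \<Rightarrow> real) \<Rightarrow> nat \<Rightarrow> nat \<Rightarrow> real" where
  "block_var nc y c s =
    1 / real (nc c) * (\<Sum>k=1..nc c. (y k c s - block_mean nc y c s)\<^sup>2)"

definition block_cov ::
    "(nat \<Rightarrow> nat) \<Rightarrow> (nat \<Rightarrow> nat \<Rightarrow> nat \<Rightarrow> real) \<Rightarrow> nat \<Rightarrow> nat \<Rightarrow> nat \<Rightarrow> real" where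
  "block_cov nc y c s t =
    1 / real (nc c) * (\<Sum>k=1..nc c.
      (y k c s - block_mean nc y c s) * (y k c t - block_mean nc y c t))"

definition sate ::
    "nat \<Rightarrow> nat \<Rightarrow> (nat \<Rightarrow> nat) \<Rightarrow> (nat \<Rightarrow> nat \<Rightarrow> nat \<Rightarrow> real) \<Rightarrow> nat \<Rightarrow> nat \<Rightarrow> real" where
  "sate n b nc y s t = 1 / real n * (\<Sum>c=1..b. \<Sum>k=1..nc c. y k c s - y k c t)"

definition diff_estimator ::
    "nat \<Rightarrow> nat \<Rightarrow> (nat \<Rightarrow> nat) \<Rightarrow> (nat \<Rightarrow> nat \<Rightarrow> nat \<Rightarrow> real) \<Rightarrow> nat \<Rightarrow> nat
      \<Rightarrow> (nat \<Rightarrow> nat \<Rightarrow> nat) \<Rightarrow> real" where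
  "diff_estimator n b nc y s t W =
    (\<Sum>c=1..b. real (nc c) / real n *
      (\<Sum>k=1..nc c. y k c s * treat W k c s / num_treated nc W c s
                    - y k c t * treat W k c t / num_treated nc W c t))"

end

theory Submission
  imports Defs
begin

text \<open>
  Within a block of size \<open>m\<close>, let \<open>a\<^sub>s\<close> be the number of units given treatment \<open>s\<close>. The
  variables \<open>T\<^sub>k\<^sub>s / a\<^sub>s\<close> are exchangeable in \<open>k\<close> and their sum over \<open>k\<close> is \<open>1\<close>, so each of them
  has mean \<open>1/m\<close>; in the same way \<open>T\<^sub>k\<^sub>s / a\<^sub>s\<^sup>2\<close> has mean \<open>E(1/a\<^sub>s)/m\<close>. The mixed second
  moments, for one treatment or for two, do not depend on the pair \<open>k \<noteq> l\<close> of units, so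
  they are determined by the diagonal ones, because all of them add up to \<open>1\<close>. Finally
  \<open>E(1/a\<^sub>s)\<close> does not depend on \<open>s\<close>, whereas \<open>\<Sum>s. 1/a\<^sub>s\<close> is deterministic for balanced
  assignments. Independence of the blocks makes the block variances add up.
\<close>

section \<open>Moments of sums under product distributions\<close>

lemma integrable_Pi_pmf_finite:
  fixes h :: "_ \<Rightarrow> real"
  assumes "finite A" and "\<And>c. c \<in> A \<Longrightarrow> finite (set_pmf (p c))"
  shows "integrable (measure_pmf (Pi_pmf A dflt p)) h"
proof (rule integrable_measure_pmf_finite)
  show "finite (set_pmf (Pi_pmf A dflt p))"
    unfolding set_Pi_pmf[OF assms(1)] by (rule finite_PiE_dflt) (use assms in auto)
qed

lemma expectation_Pi_pmf_component:
  fixes h :: "'b \<Rightarrow> real"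
  assumes "finite A" "c \<in> A"
  shows "measure_pmf.expectation (Pi_pmf A dflt p) (\<lambda>W. h (W c)) = measure_pmf.expectation (p c) h"
proof -
  have "map_pmf (\<lambda>W. W c) (Pi_pmf A dflt p) = p c"
    using assms by (simp add: Pi_pmf_component)
  then show ?thesis
    by (metis integral_map_pmf)
qed

text \<open>By independence each cross term factors into a product of two means, and these vanish.
  Only the diagonal terms survive, and each depends on one component alone.\<close>

lemma Pi_pmf_second_moment_sum:
  fixes g :: "'a \<Rightarrow> 'b \<Rightarrow> real"
  assumes A: "finite A"
    and fin: "\<And>c. c \<in> A \<Longrightarrow> finite (set_pmf (p c))"
    and centred: "\<And>c. c \<in> A \<Longrightarrow> measure_pmf.expectation (p c) (g c) = 0"
  shows "measure_pmf.expectation (Pi_pmf A dflt p) (\<lambda>W. (\<Sum>c\<in>A. g c (W c))\<^sup>2)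
    = (\<Sum>c\<in>A. measure_pmf.expectation (p c) (\<lambda>f. (g c f)\<^sup>2))"
proof -
  let ?P = "Pi_pmf A dflt p"
  have int: "integrable (measure_pmf ?P) h" for h :: "_ \<Rightarrow> real"
    using A fin by (rule integrable_Pi_pmf_finite)
  note marginal = expectation_Pi_pmf_component[OF A]
  have cross: "measure_pmf.expectation ?P (\<lambda>W. g c (W c) * g d (W d)) = 0"
    if "c \<in> A" "d \<in> A" "c \<noteq> d" for c d
  proof -
    have "prob_space.indep_vars (measure_pmf ?P) (\<lambda>_. borel) (\<lambda>c W. g c (W c)) A"
      by (intro prob_space.indep_vars_compose2[OF _ indep_vars_Pi_pmf])
        (use A in \<open>auto simp: measure_pmf.prob_space_axioms\<close>)
    then have "prob_space.indep_vars (measure_pmf ?P) (\<lambda>_. borel) (\<lambda>c W. g c (W c)) {c, d}"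
      by (rule prob_space.indep_vars_subset[OF measure_pmf.prob_space_axioms])
        (use that in auto)
    then have "measure_pmf.expectation ?P (\<lambda>W. \<Prod>i\<in>{c, d}. g i (W i))
        = (\<Prod>i\<in>{c, d}. measure_pmf.expectation ?P (\<lambda>W. g i (W i)))"
      by (intro prob_space.indep_vars_lebesgue_integral measure_pmf.prob_space_axioms int) auto
    then show ?thesis
      using that by (simp add: marginal centred)
  qed
  have "measure_pmf.expectation ?P (\<lambda>W. (\<Sum>c\<in>A. g c (W c))\<^sup>2)
      = (\<Sum>c\<in>A. \<Sum>d\<in>A. measure_pmf.expectation ?P (\<lambda>W. g c (W c) * g d (W d)))"
    by (simp add: power2_eq_square sum_product Bochner_Integration.integral_sum int)
  also have "\<dots> = (\<Sum>c\<in>A. \<Sum>d\<in>A. if d = c then measure_pmf.expectation ?P (\<lambda>W. (g c (W c))\<^sup>2) else 0)"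
    by (intro sum.cong refl) (use cross in \<open>auto simp: power2_eq_square\<close>)
  also have "\<dots> = (\<Sum>c\<in>A. measure_pmf.expectation (p c) (\<lambda>f. (g c f)\<^sup>2))"
    using A by (simp add: marginal[where h = "\<lambda>f. (g _ f)\<^sup>2"] cong: sum.cong)
  finally show ?thesis .
qed

text \<open>The kernel is the constant \<beta> plus \<alpha> - \<beta> on the diagonal. The constant
  part contributes \<beta> times \<open>sum u A * sum v A\<close>, so it is enough that one of the
  two weight functions sums to zero.\<close>

lemma sum_two_level_kernel:
  fixes u v :: "'a \<Rightarrow> real"
  assumes "finite A" "sum u A = 0"
  shows "(\<Sum>k\<in>A. \<Sum>l\<in>A. u k * v l * (if k = l then \<alpha> else \<beta>))
    = (\<alpha> - \<beta>) * (\<Sum>k\<in>A. u k * v k)"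
proof -
  have "(\<Sum>k\<in>A. \<Sum>l\<in>A. u k * v l * (if k = l then \<alpha> else \<beta>))
      = (\<Sum>k\<in>A. \<Sum>l\<in>A. u k * v l * \<beta> + (if k = l then u k * v k * (\<alpha> - \<beta>) else 0))"
    by (intro sum.cong refl) (auto simp: algebra_simps)
  also have "\<dots> = (\<Sum>k\<in>A. u k * (sum v A * \<beta>)) + (\<alpha> - \<beta>) * (\<Sum>k\<in>A. u k * v k)"
    using assms by (simp add: sum.distrib sum_distrib_left sum_distrib_right mult_ac)
  also have "(\<Sum>k\<in>A. u k * (sum v A * \<beta>)) = 0"
    using assms by (simp flip: sum_distrib_right)
  finally show ?thesis by simp
qed

section \<open>Group sizes and shares of a single assignment\<close>

definition group_size :: "nat \<Rightarrow> (nat \<Rightarrow> nat) \<Rightarrow> nat \<Rightarrow> nat" where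
  "group_size m f s = card {k \<in> {1..m}. f k = s}"

text \<open>This is the weight of unit \<open>k\<close> in the sample mean of the group given
  \<open>s\<close>. The difference in means is therefore linear in the shares, although the group
  sizes are random.\<close>

definition share :: "nat \<Rightarrow> nat \<Rightarrow> nat \<Rightarrow> (nat \<Rightarrow> nat) \<Rightarrow> real" where
  "share m s k f = (if f k = s then 1 / real (group_size m f s) else 0)"

lemma group_size_comp_permutes:
  assumes "\<pi> permutes {1..m}"
  shows "group_size m (f \<circ> \<pi>) s = group_size m f s"
proof -
  have "{k \<in> \<pi> ` {1..m}. f k = s} = \<pi> ` {k \<in> {1..m}. (f \<circ> \<pi>) k = s}"
    by auto
  then have "{k \<in> {1..m}. f k = s} = \<pi> ` {k \<in> {1..m}. (f \<circ> \<pi>) k = s}"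
    unfolding permutes_image[OF assms] .
  then show ?thesis
    unfolding group_size_def using permutes_inj_on[OF assms] by (simp add: card_image)
qed

lemma sum_share:
  assumes "group_size m f s > 0"
  shows "(\<Sum>k=1..m. share m s k f) = 1"
proof -
  have "(\<Sum>k=1..m. share m s k f) = (\<Sum>k\<in>{k \<in> {1..m}. f k = s}. 1 / real (group_size m f s))"
    unfolding share_def by (rule sum.inter_filter[symmetric]) simp
  also have "\<dots> = 1"
    unfolding sum_constant group_size_def[symmetric] using assms by simp
  finally show ?thesis .
qed

text \<open>A share is 0 or the inverse group size, so squaring it only multiplies it by that
  inverse; the shares themselves sum to 1.\<close>

lemma sum_share_square:
  assumes "group_size m f s > 0"
  shows "(\<Sum>k=1..m. (share m s k f)\<^sup>2) = 1 / real (group_size m f s)"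
proof -
  have "(\<Sum>k=1..m. (share m s k f)\<^sup>2) = (\<Sum>k=1..m. share m s k f * (1 / real (group_size m f s)))"
    by (intro sum.cong refl) (simp add: share_def power2_eq_square)
  also have "\<dots> = 1 / real (group_size m f s)"
    unfolding sum_distrib_right[symmetric] sum_share[OF assms] by simp
  finally show ?thesis .
qed

text \<open>The first transposition takes \<open>k\<close> to \<open>k'\<close>; the second takes
  the image of \<open>l\<close> to \<open>l'\<close>. The second one fixes \<open>k'\<close>,
  because neither the image of \<open>l\<close> nor \<open>l'\<close> equals
  \<open>k'\<close>.\<close>

lemma permutes_move_pair:
  assumes "k \<in> S" "l \<in> S" "k' \<in> S" "l' \<in> S" "k \<noteq> l" "k' \<noteq> l'"
  obtains \<pi> where "\<pi> permutes S" "\<pi> k = k'" "\<pi> l = l'"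
proof
  let ?\<rho> = "Transposition.transpose k k'"
  let ?\<pi> = "Transposition.transpose (?\<rho> l) l' \<circ> ?\<rho>"
  have "?\<rho> l \<in> S"
    using assms by (auto simp: Transposition.transpose_def)
  then show "?\<pi> permutes S"
    using assms by (intro permutes_compose permutes_swap_id)
  show "?\<pi> k = k'" "?\<pi> l = l'"
    using assms by (auto simp: Transposition.transpose_def)
qed

section \<open>The uniform distribution on the balanced assignments of one block, and its
  symmetries\<close>

locale balanced_block =
  fixes r m :: nat
  assumes two_le_r: "2 \<le> r" and r_le_m: "r \<le> m"
begin

abbreviation expect :: "((nat \<Rightarrow> nat) \<Rightarrow> real) \<Rightarrow> real" where
  "expect \<equiv> measure_pmf.expectation (pmf_of_set (balanced_assignments r m))"

lemma finite_balanced: "finite (balanced_assignments r m)"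
  unfolding balanced_assignments_def
  by (rule finite_subset[of _ "{1..m} \<rightarrow>\<^sub>E {1..r}"]) (auto intro: finite_PiE)

text \<open>Treatments 1 to \<open>m mod r\<close> get the extra unit, so treatment \<open>s\<close>
  offers \<open>n s\<close> slots. The set \<open>S\<close> of all slots has \<open>m\<close>
  elements; a bijection from units to slots, followed by the first projection, is a balanced
  assignment.\<close>

lemma balanced_nonempty: "balanced_assignments r m \<noteq> {}"
proof -
  define n where "n s = m div r + (if s \<in> {1..m mod r} then 1 else 0)" for s
  define S where "S = (SIGMA s:{1..r}. {..<n s})"
  have z: "m mod r < r"
    using two_le_r by simp
  then have sub: "{1..m mod r} \<subseteq> {1..r}"
    by auto
  have "card S = (\<Sum>s\<in>{1..r}. n s)"
    by (simp add: S_def)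
  also have "\<dots> = r * (m div r) + (\<Sum>s\<in>{1..r}. if s \<in> {1..m mod r} then 1 else 0)"
    by (simp only: n_def sum.distrib) simp
  also have "(\<Sum>s\<in>{1..r}. if s \<in> {1..m mod r} then 1 else 0) = card ({1..r} \<inter> {1..m mod r})"
    by (subst sum.inter_restrict[symmetric]) auto
  also have "{1..r} \<inter> {1..m mod r} = {1..m mod r}"
    using sub by auto
  finally have "card S = card {1..m}"
    by simp
  moreover have "finite S"
    by (simp add: S_def)
  ultimately obtain h where h: "bij_betw h {1..m} S"
    by (metis finite_same_card_bij finite_atLeastAtMost)
  define f where "f = restrict (fst \<circ> h) {1..m}"
  have fibre: "card {k \<in> {1..m}. f k = s} = n s" if "s \<in> {1..r}" for s
  proof -
    have img: "h ` {k \<in> {1..m}. f k = s} = {s} \<times> {..<n s}"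
    proof (intro equalityI subsetI)
      fix x assume "x \<in> h ` {k \<in> {1..m}. f k = s}"
      then show "x \<in> {s} \<times> {..<n s}"
        using bij_betwE[OF h] by (force simp: f_def S_def)
    next
      fix x assume x: "x \<in> {s} \<times> {..<n s}"
      then have "x \<in> S"
        using that by (auto simp: S_def)
      then obtain k where k: "k \<in> {1..m}" "h k = x"
        using bij_betw_imp_surj_on[OF h] by blast
      then have "k \<in> {k \<in> {1..m}. f k = s}"
        using x by (auto simp: f_def)
      then show "x \<in> h ` {k \<in> {1..m}. f k = s}"
        using k by blast
    qed
    have inj: "inj_on h {k \<in> {1..m}. f k = s}"
      by (rule inj_on_subset[OF bij_betw_imp_inj_on[OF h]]) blast
    show ?thesis
      unfolding card_image[OF inj, symmetric] img by simp
  qed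
  have "f \<in> {1..m} \<rightarrow>\<^sub>E {1..r}"
    using bij_betwE[OF h] by (force simp: f_def S_def)
  moreover have "\<forall>s\<in>{1..m mod r}. card {k \<in> {1..m}. f k = s} = m div r + 1"
    using sub fibre by (auto simp: n_def)
  moreover have "\<forall>s\<in>{1..r} - {1..m mod r}. card {k \<in> {1..m}. f k = s} = m div r"
    using fibre by (auto simp: n_def)
  ultimately have "f \<in> balanced_assignments r m"
    unfolding balanced_assignments_def
    using sub by (intro CollectI conjI exI[of _ "{1..m mod r}"]) auto
  then show ?thesis
    by blast
qed

lemma set_pmf_balanced:
  "set_pmf (pmf_of_set (balanced_assignments r m)) = balanced_assignments r m"
  using finite_balanced balanced_nonempty by simp

lemma integrable_balanced:
  "integrable (measure_pmf (pmf_of_set (balanced_assignments r m))) (X :: _ \<Rightarrow> real)"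
  by (rule integrable_measure_pmf_finite) (simp add: set_pmf_balanced finite_balanced)

lemma expect_cong:
  assumes "\<And>f. f \<in> balanced_assignments r m \<Longrightarrow> X f = Y f"
  shows "expect X = expect Y"
  by (intro integral_cong_AE) (auto simp: AE_measure_pmf_iff set_pmf_balanced assms)

lemma expect_sum: "expect (\<lambda>f. \<Sum>i\<in>I. X i f) = (\<Sum>i\<in>I. expect (X i))"
  by (rule Bochner_Integration.integral_sum) (rule integrable_balanced)

text \<open>An injective self-map of a finite set is a bijection, so it preserves the uniform
  distribution. Both symmetries below, of units and of treatments, come from this.\<close>

lemma expect_invariant:
  assumes "inj_on g (balanced_assignments r m)"
    and "g ` balanced_assignments r m \<subseteq> balanced_assignments r m"
  shows "expect (\<lambda>f. X (g f)) = expect X"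
proof -
  have "g ` balanced_assignments r m = balanced_assignments r m"
    using endo_inj_surj[OF finite_balanced assms(2,1)] .
  then have "map_pmf g (pmf_of_set (balanced_assignments r m)) = pmf_of_set (balanced_assignments r m)"
    using map_pmf_of_set_inj[OF assms(1) balanced_nonempty finite_balanced] by simp
  then show ?thesis
    by (metis integral_map_pmf)
qed

text \<open>Permuting units preserves all group sizes. A permutation of {1..m} is the identity
  elsewhere, so \<open>f \<circ> \<pi>\<close> stays extensional without a restriction.\<close>

lemma expect_permute_units:
  assumes \<pi>: "\<pi> permutes {1..m}"
  shows "expect (\<lambda>f. X (f \<circ> \<pi>)) = expect X"
proof (rule expect_invariant)
  show "inj_on (\<lambda>f. f \<circ> \<pi>) (balanced_assignments r m)"
    by (intro inj_onI) (metis comp_assoc comp_id permutes_inv_o(1)[OF \<pi>])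
  show "(\<lambda>f. f \<circ> \<pi>) ` balanced_assignments r m \<subseteq> balanced_assignments r m"
  proof (intro image_subsetI)
    fix f assume f: "f \<in> balanced_assignments r m"
    then have "f \<circ> \<pi> \<in> {1..m} \<rightarrow>\<^sub>E {1..r}"
      using permutes_in_image[OF \<pi>] permutes_not_in[OF \<pi>]
      by (auto simp: balanced_assignments_def PiE_iff extensional_def simp del: atLeastAtMost_iff)
    then show "f \<circ> \<pi> \<in> balanced_assignments r m"
      using f group_size_comp_permutes[OF \<pi>, unfolded group_size_def, of f]
      unfolding balanced_assignments_def by simp
  qed
qed

lemma expect_swap_treatments:
  assumes s: "s \<in> {1..r}" and t: "t \<in> {1..r}"
  shows "expect (\<lambda>f. X (restrict (Transposition.transpose s t \<circ> f) {1..m})) = expect X"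
proof (rule expect_invariant)
  let ?\<tau> = "Transposition.transpose s t"
  \<comment> \<open>Outside {1..m} the value of \<open>f\<close> is \<open>undefined\<close>, which
    the transposition could move; the restriction puts it back.\<close>
  let ?g = "\<lambda>f. restrict (?\<tau> \<circ> f) {1..m}"
  show "inj_on ?g (balanced_assignments r m)"
  proof (rule inj_onI)
    fix f f' assume f: "f \<in> balanced_assignments r m" "f' \<in> balanced_assignments r m"
      and eq: "?g f = ?g f'"
    show "f = f'"
    proof (rule extensionalityI[of _ "{1..m}"])
      show "f \<in> extensional {1..m}" "f' \<in> extensional {1..m}"
        using f by (auto simp: balanced_assignments_def PiE_iff)
      fix k assume "k \<in> {1..m}"
      then have "?\<tau> (f k) = ?\<tau> (f' k)"
        using fun_cong[OF eq, of k] by simp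
      then show "f k = f' k"
        by (metis transpose_involutory)
    qed
  qed
  have \<tau>_r: "?\<tau> x \<in> {1..r} \<longleftrightarrow> x \<in> {1..r}" for x
    using permutes_in_image[OF permutes_swap_id[OF s t]] .
  show "?g ` balanced_assignments r m \<subseteq> balanced_assignments r m"
  proof (intro image_subsetI)
    fix f assume f: "f \<in> balanced_assignments r m"
    then obtain Z where Z: "Z \<subseteq> {1..r}" "card Z = m mod r"
      "\<forall>s\<in>Z. card {k \<in> {1..m}. f k = s} = m div r + 1"
      "\<forall>s\<in>{1..r} - Z. card {k \<in> {1..m}. f k = s} = m div r"
      unfolding balanced_assignments_def by blast
    \<comment> \<open>A transposition is its own inverse, so the group of \<open>x\<close> after the
      swap is the group of its image before. The set of larger groups thus becomes the image of
      \<open>Z\<close>.\<close>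
    have fibre: "{k \<in> {1..m}. ?g f k = x} = {k \<in> {1..m}. f k = ?\<tau> x}" for x
      by (auto simp del: atLeastAtMost_iff)
    have in_\<tau>: "?\<tau> x \<in> Z" if "x \<in> ?\<tau> ` Z" for x
      using that by auto
    have notin_\<tau>: "?\<tau> x \<in> {1..r} - Z" if "x \<in> {1..r} - ?\<tau> ` Z" for x
      using that \<tau>_r[of x] by (metis Diff_iff image_eqI transpose_involutory)
    have "?\<tau> ` Z \<subseteq> {1..r}"
      using Z(1) \<tau>_r by blast
    moreover have "card (?\<tau> ` Z) = m mod r"
      using Z(2) by (simp add: card_image)
    moreover have "\<forall>x\<in>?\<tau> ` Z. card {k \<in> {1..m}. ?g f k = x} = m div r + 1"
      unfolding fibre using Z(3) in_\<tau> by blast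
    moreover have "\<forall>x\<in>{1..r} - ?\<tau> ` Z. card {k \<in> {1..m}. ?g f k = x} = m div r"
      unfolding fibre using Z(4) notin_\<tau> by blast
    moreover have "?g f \<in> {1..m} \<rightarrow>\<^sub>E {1..r}"
      using f \<tau>_r by (auto simp: balanced_assignments_def PiE_iff simp del: atLeastAtMost_iff)
    ultimately show "?g f \<in> balanced_assignments r m"
      unfolding balanced_assignments_def by blast
  qed
qed

section \<open>Group sizes in a balanced assignment\<close>

lemma group_size_pos:
  assumes "f \<in> balanced_assignments r m" "s \<in> {1..r}"
  shows "group_size m f s > 0"
proof -
  have "group_size m f s = m div r + 1 \<or> group_size m f s = m div r"
    using assms unfolding balanced_assignments_def group_size_def by blast
  moreover have "m div r > 0"
    using two_le_r r_le_m by (simp add: div_greater_zero_iff)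
  ultimately show ?thesis
    by auto
qed

text \<open>The set \<open>Z\<close> of treatments with larger groups varies with \<open>f\<close>,
  but the sum sees only its cardinality \<open>m mod r\<close>.\<close>

lemma sum_inverse_group_sizes:
  assumes "f \<in> balanced_assignments r m"
  shows "(\<Sum>s=1..r. 1 / real (group_size m f s))
    = real (m mod r) / (real (m div r) + 1) + (real r - real (m mod r)) / real (m div r)"
proof -
  from assms obtain Z where Z: "Z \<subseteq> {1..r}" "card Z = m mod r"
    "\<forall>s\<in>Z. group_size m f s = m div r + 1" "\<forall>s\<in>{1..r} - Z. group_size m f s = m div r"
    unfolding balanced_assignments_def group_size_def by blast
  have fin: "finite Z"
    using Z(1) finite_subset by blast
  have "(\<Sum>s=1..r. 1 / real (group_size m f s))
      = (\<Sum>s\<in>{1..r} - Z. 1 / real (group_size m f s)) + (\<Sum>s\<in>Z. 1 / real (group_size m f s))"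
    by (rule sum.subset_diff) (use Z(1) in auto)
  also have "\<dots> = (\<Sum>s\<in>{1..r} - Z. 1 / real (m div r)) + (\<Sum>s\<in>Z. 1 / (real (m div r) + 1))"
    using Z by (simp add: add.commute)
  also have "\<dots> = (real r - real (m mod r)) / real (m div r) + real (m mod r) / (real (m div r) + 1)"
  proof -
    have "m mod r \<le> r"
      using two_le_r by (simp add: less_imp_le)
    then have "real (card ({1..r} - Z)) = real r - real (m mod r)"
      unfolding card_Diff_subset[OF fin Z(1)] Z(2) by (simp add: of_nat_diff)
    then show ?thesis
      by (simp add: Z(2))
  qed
  finally show ?thesis
    by simp
qed

text \<open>
  With \<open>q = m div r\<close> and \<open>z = m mod r\<close>, this is \<open>(z/r) / (q + 1) + ((r - z)/r) / q\<close>, rewritten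
  by \<open>r q = m - z\<close>.
\<close>

definition mean_inverse_group_size :: real where
  "mean_inverse_group_size
    = real (m mod r) / (real m + real r - real (m mod r))
      + (real r - real (m mod r)) / (real m - real (m mod r))"

text \<open>Averaging over treatments replaces any computation of the distribution of a group size:
  the \<open>r\<close> expectations agree by symmetry and their sum is a constant.\<close>

lemma expect_inverse_group_size:
  assumes s: "s \<in> {1..r}"
  shows "expect (\<lambda>f. 1 / real (group_size m f s)) = mean_inverse_group_size"
proof -
  have eq: "expect (\<lambda>f. 1 / real (group_size m f t)) = expect (\<lambda>f. 1 / real (group_size m f s))"
    if t: "t \<in> {1..r}" for t
  proof -
    \<comment> \<open>After \<open>s\<close> and \<open>t\<close> are swapped, the units given
      \<open>t\<close> are those that \<open>f\<close> gave \<open>s\<close>.\<close>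
    have "group_size m (restrict (Transposition.transpose s t \<circ> f) {1..m}) t = group_size m f s" for f
      unfolding group_size_def by (rule arg_cong[of _ _ card]) (auto simp: transpose_eq_iff)
    then show ?thesis
      using expect_swap_treatments[OF s t, of "\<lambda>f. 1 / real (group_size m f t)"] by simp
  qed
  have q: "m div r > 0"
    using two_le_r r_le_m by (simp add: div_greater_zero_iff)
  have "m = r * (m div r) + m mod r"
    by simp
  then have m: "real m = real r * real (m div r) + real (m mod r)"
    by (metis of_nat_add of_nat_mult)
  have "real r * expect (\<lambda>f. 1 / real (group_size m f s))
      = (\<Sum>t=1..r. expect (\<lambda>f. 1 / real (group_size m f t)))"
    using eq by simp
  also have "\<dots> = expect (\<lambda>f. \<Sum>t=1..r. 1 / real (group_size m f t))"
    by (rule expect_sum[symmetric])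
  also have "\<dots> = expect (\<lambda>f. real (m mod r) / (real (m div r) + 1)
      + (real r - real (m mod r)) / real (m div r))"
    by (rule expect_cong) (rule sum_inverse_group_sizes)
  also have "\<dots> = real (m mod r) / (real (m div r) + 1)
      + (real r - real (m mod r)) / real (m div r)"
    by simp
  also have "\<dots> = real r * mean_inverse_group_size"
  proof -
    have denominators: "real m + real r - real (m mod r) = real r * (real (m div r) + 1)"
      "real m - real (m mod r) = real r * real (m div r)"
      using m by (simp_all add: algebra_simps)
    show ?thesis
      unfolding mean_inverse_group_size_def denominators
      using two_le_r by (simp add: distrib_left[of "real r" "_ / _"])
  qed
  finally show ?thesis
    using two_le_r by simp
qed

section \<open>Moments of the shares and of linear combinations of them\<close>

lemma share_comp_permutes:
  assumes "\<pi> permutes {1..m}"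
  shows "share m s k (f \<circ> \<pi>) = share m s (\<pi> k) f"
  by (simp add: share_def group_size_comp_permutes[OF assms])

lemma m_gt_1: "m > 1"
  using two_le_r r_le_m by simp

lemma expect_share:
  assumes s: "s \<in> {1..r}" and k: "k \<in> {1..m}"
  shows "expect (share m s k) = 1 / real m"
proof -
  have eq: "expect (share m s l) = expect (share m s k)" if "l \<in> {1..m}" for l
  proof -
    have \<pi>: "Transposition.transpose k l permutes {1..m}"
      using k that by (rule permutes_swap_id)
    show ?thesis
      using expect_permute_units[OF \<pi>, of "share m s k"]
      by (simp add: share_comp_permutes[OF \<pi>])
  qed
  have "real m * expect (share m s k) = (\<Sum>l=1..m. expect (share m s l))"
    using eq by simp
  also have "\<dots> = expect (\<lambda>f. \<Sum>l=1..m. share m s l f)"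
    by (rule expect_sum[symmetric])
  also have "\<dots> = expect (\<lambda>_. 1)"
    by (rule expect_cong) (use sum_share group_size_pos s in blast)
  finally show ?thesis
    using m_gt_1 by (simp add: field_simps)
qed

text \<open>The square is written as a product to match the premise \<open>diag\<close> of
  \<open>expect_share_mult\<close> in the case \<open>t = s\<close>.\<close>

lemma expect_share_square:
  assumes s: "s \<in> {1..r}" and k: "k \<in> {1..m}"
  shows "expect (\<lambda>f. share m s k f * share m s k f) = mean_inverse_group_size / real m"
proof -
  have eq: "expect (\<lambda>f. (share m s l f)\<^sup>2) = expect (\<lambda>f. (share m s k f)\<^sup>2)" if "l \<in> {1..m}" for l
  proof -
    have \<pi>: "Transposition.transpose k l permutes {1..m}"
      using k that by (rule permutes_swap_id)
    show ?thesis
      using expect_permute_units[OF \<pi>, of "\<lambda>f. (share m s k f)\<^sup>2"]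
      by (simp add: share_comp_permutes[OF \<pi>])
  qed
  have "real m * expect (\<lambda>f. (share m s k f)\<^sup>2) = (\<Sum>l=1..m. expect (\<lambda>f. (share m s l f)\<^sup>2))"
    using eq by simp
  also have "\<dots> = expect (\<lambda>f. \<Sum>l=1..m. (share m s l f)\<^sup>2)"
    by (rule expect_sum[symmetric])
  also have "\<dots> = expect (\<lambda>f. 1 / real (group_size m f s))"
    by (rule expect_cong) (use sum_share_square group_size_pos s in blast)
  also have "\<dots> = mean_inverse_group_size"
    by (rule expect_inverse_group_size[OF s])
  finally show ?thesis
    using m_gt_1 by (simp add: field_simps power2_eq_square)
qed

text \<open>All off-diagonal moments share one value \<beta>, since a permutation carries any
  ordered pair of distinct units to any other. As the shares of each treatment sum to 1, taking
  expectations of the product of both sums gives 1 = m \<alpha> + m (m - 1) \<beta>. The parameter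
  \<alpha> lets one argument serve both equal and distinct treatments.\<close>

lemma expect_share_mult:
  assumes s: "s \<in> {1..r}" and t: "t \<in> {1..r}"
    and diag: "\<And>k. k \<in> {1..m} \<Longrightarrow> expect (\<lambda>f. share m s k f * share m t k f) = \<alpha>"
    and k: "k \<in> {1..m}" and l: "l \<in> {1..m}"
  shows "expect (\<lambda>f. share m s k f * share m t l f)
    = (if k = l then \<alpha> else (1 - real m * \<alpha>) / (real m * (real m - 1)))"
proof (cases "k = l")
  case False
  let ?e = "\<lambda>k l. expect (\<lambda>f. share m s k f * share m t l f)"
  have eq: "?e k' l' = (if k' = l' then \<alpha> else ?e k l)" if kl': "k' \<in> {1..m}" "l' \<in> {1..m}" for k' l'
  proof (cases "k' = l'")
    case neq: False
    obtain \<pi> where \<pi>: "\<pi> permutes {1..m}" "\<pi> k = k'" "\<pi> l = l'"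
      using permutes_move_pair[OF k l kl' False neq] .
    show ?thesis
      using expect_permute_units[OF \<pi>(1), of "\<lambda>f. share m s k f * share m t l f"] neq
      by (simp add: share_comp_permutes[OF \<pi>(1)] \<pi>)
  qed (use diag kl' in simp)
  have "1 = expect (\<lambda>_. 1)"
    by simp
  also have "\<dots> = expect (\<lambda>f. (\<Sum>k'=1..m. share m s k' f) * (\<Sum>l'=1..m. share m t l' f))"
    by (rule expect_cong) (simp only: sum_share group_size_pos s t mult_1)
  also have "\<dots> = (\<Sum>k'=1..m. \<Sum>l'=1..m. ?e k' l')"
    by (simp add: sum_product expect_sum)
  also have "\<dots> = (\<Sum>k'=1..m. \<Sum>l'=1..m. if k' = l' then \<alpha> else ?e k l)"
    by (intro sum.cong refl eq)
  also have "\<dots> = (\<Sum>k'=1..m. \<Sum>l'=1..m. ?e k l + (if k' = l' then \<alpha> - ?e k l else 0))"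
    by (intro sum.cong refl) simp
  also have "\<dots> = real m * \<alpha> + real m * (real m - 1) * ?e k l"
    by (simp add: sum.distrib algebra_simps)
  finally have "?e k l * (real m * (real m - 1)) = 1 - real m * \<alpha>"
    by (simp add: algebra_simps)
  moreover have "real m * (real m - 1) \<noteq> 0"
    using m_gt_1 by simp
  ultimately show ?thesis
    using False by (simp add: eq_divide_eq)
qed (use diag k in simp)

text \<open>The matrix of second moments has two levels, so \<open>sum_two_level_kernel\<close>
  applies; the factor in front is the gap between diagonal and off-diagonal moments.\<close>

lemma expect_linear_mult:
  assumes s: "s \<in> {1..r}" and t: "t \<in> {1..r}"
    and diag: "\<And>k. k \<in> {1..m} \<Longrightarrow> expect (\<lambda>f. share m s k f * share m t k f) = \<alpha>"
    and u: "(\<Sum>k=1..m. u k) = 0"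
  shows "expect (\<lambda>f. (\<Sum>k=1..m. u k * share m s k f) * (\<Sum>k=1..m. v k * share m t k f))
    = (real m * \<alpha> - 1 / real m) / (real m - 1) * (\<Sum>k=1..m. u k * v k)"
proof -
  let ?\<beta> = "(1 - real m * \<alpha>) / (real m * (real m - 1))"
  have "expect (\<lambda>f. (\<Sum>k=1..m. u k * share m s k f) * (\<Sum>k=1..m. v k * share m t k f))
      = expect (\<lambda>f. \<Sum>k=1..m. \<Sum>l=1..m. u k * v l * (share m s k f * share m t l f))"
    by (simp add: sum_product mult_ac)
  also have "\<dots> = (\<Sum>k=1..m. \<Sum>l=1..m. u k * v l * expect (\<lambda>f. share m s k f * share m t l f))"
    by (simp add: expect_sum)
  also have "\<dots> = (\<Sum>k=1..m. \<Sum>l=1..m. u k * v l * (if k = l then \<alpha> else ?\<beta>))"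
    by (intro sum.cong refl arg_cong2[of _ _ _ _ "(*)"] expect_share_mult[OF s t diag])
  also have "\<dots> = (\<alpha> - ?\<beta>) * (\<Sum>k=1..m. u k * v k)"
    by (rule sum_two_level_kernel) (use u in auto)
  also have "\<alpha> - ?\<beta> = (real m * \<alpha> - 1 / real m) / (real m - 1)"
    using m_gt_1 by (simp add: divide_simps) (simp add: algebra_simps)
  finally show ?thesis .
qed

lemma expect_linear:
  assumes s: "s \<in> {1..r}"
  shows "expect (\<lambda>f. \<Sum>k=1..m. u k * share m s k f) = (\<Sum>k=1..m. u k) / real m"
  by (simp add: expect_sum expect_share[OF s] sum_divide_distrib)

text \<open>For centred outcomes \<open>u\<close> and \<open>v\<close>, the quotients by
  \<open>m\<close> are the block variances and covariance. The two group means have covariance -1/(m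
  - 1) times the block covariance, which is why it enters the variance of the difference with a plus
  sign.\<close>

lemma expect_linear_difference_square:
  assumes s: "s \<in> {1..r}" and t: "t \<in> {1..r}" and "s \<noteq> t"
    and u: "(\<Sum>k=1..m. u k) = 0" and v: "(\<Sum>k=1..m. v k) = 0"
  shows "expect (\<lambda>f. ((\<Sum>k=1..m. u k * share m s k f) - (\<Sum>k=1..m. v k * share m t k f))\<^sup>2)
    = ((real m * mean_inverse_group_size - 1) * ((\<Sum>k=1..m. (u k)\<^sup>2) / real m + (\<Sum>k=1..m. (v k)\<^sup>2) / real m)
        + 2 * ((\<Sum>k=1..m. u k * v k) / real m)) / (real m - 1)"
proof -
  let ?U = "\<lambda>f. \<Sum>k=1..m. u k * share m s k f" and ?V = "\<lambda>f. \<Sum>k=1..m. v k * share m t k f"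
  have uu: "expect (\<lambda>f. ?U f * ?U f) = (mean_inverse_group_size - 1 / real m) / (real m - 1) * (\<Sum>k=1..m. (u k)\<^sup>2)"
    using expect_linear_mult[OF s s expect_share_square[OF s] u, of u] m_gt_1
    by (simp add: power2_eq_square)
  have vv: "expect (\<lambda>f. ?V f * ?V f) = (mean_inverse_group_size - 1 / real m) / (real m - 1) * (\<Sum>k=1..m. (v k)\<^sup>2)"
    using expect_linear_mult[OF t t expect_share_square[OF t] v, of v] m_gt_1
    by (simp add: power2_eq_square)
  \<comment> \<open>No unit receives both treatments, so \<open>expect_linear_mult\<close> applies
    with \<alpha> = 0.\<close>
  have disjoint: "share m s k f * share m t k f = 0" for k f
    using \<open>s \<noteq> t\<close> by (simp add: share_def)
  have "expect (\<lambda>f. share m s k f * share m t k f) = 0" for k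
    unfolding disjoint by simp
  note uv_linear = expect_linear_mult[OF s t this u, of v]
  have uv: "expect (\<lambda>f. ?U f * ?V f) = (- 1 / real m) / (real m - 1) * (\<Sum>k=1..m. u k * v k)"
    unfolding uv_linear by simp
  have "expect (\<lambda>f. (?U f - ?V f)\<^sup>2)
      = expect (\<lambda>f. (?U f * ?U f + ?V f * ?V f) - 2 * (?U f * ?V f))"
    by (rule expect_cong) (simp add: power2_eq_square algebra_simps)
  also have "\<dots> = expect (\<lambda>f. ?U f * ?U f) + expect (\<lambda>f. ?V f * ?V f) - 2 * expect (\<lambda>f. ?U f * ?V f)"
    by (subst Bochner_Integration.integral_diff Bochner_Integration.integral_add
        Bochner_Integration.integral_mult_right_zero; (rule integrable_balanced)?)+ simp
  also have "\<dots> = ((real m * mean_inverse_group_size - 1) * ((\<Sum>k=1..m. (u k)\<^sup>2) / real m + (\<Sum>k=1..m. (v k)\<^sup>2) / real m)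
        + 2 * ((\<Sum>k=1..m. u k * v k) / real m)) / (real m - 1)"
    unfolding uu vv uv using m_gt_1 by (simp add: divide_simps) (simp add: algebra_simps)
  finally show ?thesis .
qed

text \<open>This separates the value \<open>r - 1\<close>, attained when \<open>r\<close> divides
  \<open>m\<close>, from the correction for a nonzero remainder. The two sums in the variance
  formula arise from these two terms.\<close>

lemma mean_inverse_group_size_eq:
  "real m * mean_inverse_group_size - 1 = (real r - 1)
    + real r * real (m mod r) * (real r - real (m mod r))
      / ((real m - real (m mod r)) * (real m + real r - real (m mod r)))"
proof -
  define z where "z = real (m mod r)"
  have "m mod r < r"
    using two_le_r by simp
  then have "real m - z > 0" "real m + real r - z > 0"
    using r_le_m by (auto simp: z_def)
  then show ?thesis
    unfolding mean_inverse_group_size_def z_def[symmetric]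
    by (simp add: divide_simps) (simp add: algebra_simps)
qed

end

section \<open>Assembly of the blocks: mean and variance of the estimator\<close>

theorem theorem4:
  fixes n r b s t :: nat
    and nc z :: "nat \<Rightarrow> nat"
    and y :: "nat \<Rightarrow> nat \<Rightarrow> nat \<Rightarrow> real"
  assumes "n = (\<Sum>c=1..b. nc c)"
    and "\<And>c. c \<in> {1..b} \<Longrightarrow> r \<le> nc c"
    and "\<And>c. c \<in> {1..b} \<Longrightarrow> z c = nc c mod r"
    and "s \<in> {1..r}" and "t \<in> {1..r}" and "s \<noteq> t"
  shows "measure_pmf.expectation (balanced_block_randomization r b nc)
           (diff_estimator n b nc y s t) = sate n b nc y s t
    \<and> measure_pmf.variance (balanced_block_randomization r b nc)
        (diff_estimator n b nc y s t) =
        (\<Sum>c=1..b. (real (nc c))\<^sup>2 / (real n)\<^sup>2 *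
           ((real r - 1) / (real (nc c) - 1) * (block_var nc y c s + block_var nc y c t)
            + 2 * (block_cov nc y c s t / (real (nc c) - 1))))
      + (\<Sum>c=1..b. (real (nc c))\<^sup>2 / (real n)\<^sup>2 *
           (real r * real (z c) * (real r - real (z c))
             / ((real (nc c) - 1) * (real (nc c) - real (z c))
                  * (real (nc c) + real r - real (z c)))
            * (block_var nc y c s + block_var nc y c t)))"
proof -
  \<comment> \<open>The contribution of block \<open>c\<close> to the estimation error, written with
    centred outcomes so that the moment lemmas apply.\<close>
  define D where "D c f = real (nc c) / real n *
    ((\<Sum>k=1..nc c. (y k c s - block_mean nc y c s) * share (nc c) s k f)
      - (\<Sum>k=1..nc c. (y k c t - block_mean nc y c t) * share (nc c) t k f))" for c f
  let ?p = "\<lambda>c. pmf_of_set (balanced_assignments r (nc c))"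
  let ?P = "balanced_block_randomization r b nc"
  \<comment> \<open>Two distinct treatments in {1..r} force \<open>2 \<le> r\<close>.\<close>
  have block: "balanced_block r (nc c)" if "c \<in> {1..b}" for c
    using assms(2)[OF that] assms(4-6) by unfold_locales auto
  note fin = balanced_block.finite_balanced[OF block]
  note set_p = balanced_block.set_pmf_balanced[OF block]
  have centred: "(\<Sum>k=1..nc c. y k c x - block_mean nc y c x) = 0" if "c \<in> {1..b}" for c x
    using balanced_block.m_gt_1[OF block[OF that]] by (simp add: sum_subtractf block_mean_def)
  have mean_D: "measure_pmf.expectation (?p c) (D c) = 0" if c: "c \<in> {1..b}" for c
  proof -
    interpret balanced_block r "nc c" by (rule block[OF c])
    show ?thesis
      unfolding D_def integral_mult_right_zero
        Bochner_Integration.integral_diff[OF integrable_balanced integrable_balanced]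
        expect_linear[OF assms(4)] expect_linear[OF assms(5)] centred[OF c]
      by simp
  qed
  have var_D: "measure_pmf.expectation (?p c) (\<lambda>f. (D c f)\<^sup>2)
      = (real (nc c))\<^sup>2 / (real n)\<^sup>2 *
           ((real r - 1) / (real (nc c) - 1) * (block_var nc y c s + block_var nc y c t)
            + 2 * (block_cov nc y c s t / (real (nc c) - 1)))
      + (real (nc c))\<^sup>2 / (real n)\<^sup>2 *
           (real r * real (z c) * (real r - real (z c))
             / ((real (nc c) - 1) * (real (nc c) - real (z c))
                  * (real (nc c) + real r - real (z c)))
            * (block_var nc y c s + block_var nc y c t))" if c: "c \<in> {1..b}" for c
  proof -
    interpret balanced_block r "nc c" by (rule block[OF c])
    \<comment> \<open>Here \<open>p\<close> stands for \<open>r - 1\<close>,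
      \<open>N / (A * B)\<close> for the correction term of
      \<open>mean_inverse_group_size_eq\<close>, and \<open>d\<close> for the block size minus
      1.\<close>
    have split: "((p + N / (A * B)) * S + 2 * C) / d = (p / d * S + 2 * (C / d)) + N / (d * A * B) * S"
      for p N A B S C d :: real
      by (simp add: add_divide_distrib distrib_left distrib_right mult_ac)
    let ?S = "block_var nc y c s + block_var nc y c t"
    have "measure_pmf.expectation (?p c) (\<lambda>f. (D c f)\<^sup>2)
        = (real (nc c))\<^sup>2 / (real n)\<^sup>2 *
          (((real (nc c) * mean_inverse_group_size - 1) * ?S + 2 * block_cov nc y c s t) / (real (nc c) - 1))"
      using expect_linear_difference_square[OF assms(4,5,6) centred[OF c] centred[OF c]]
      by (simp add: D_def power_mult_distrib power_divide block_var_def block_cov_def)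
    also have "((real (nc c) * mean_inverse_group_size - 1) * ?S + 2 * block_cov nc y c s t) / (real (nc c) - 1)
        = ((real r - 1) / (real (nc c) - 1) * ?S + 2 * (block_cov nc y c s t / (real (nc c) - 1)))
          + real r * real (z c) * (real r - real (z c))
             / ((real (nc c) - 1) * (real (nc c) - real (z c))
                  * (real (nc c) + real r - real (z c))) * ?S"
      unfolding mean_inverse_group_size_eq assms(3)[OF c] by (rule split)
    finally show ?thesis
      by (simp add: distrib_left)
  qed
  \<comment> \<open>This is claimed only on the support, where every treatment group of every block
    is nonempty and its shares sum to 1.\<close>
  have decomp: "diff_estimator n b nc y s t W = sate n b nc y s t + (\<Sum>c=1..b. D c (W c))"
    if W: "W \<in> set_pmf ?P" for W
  proof -
    have "real (nc c) / real n *
        (\<Sum>k=1..nc c. y k c s * treat W k c s / num_treated nc W c s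
                      - y k c t * treat W k c t / num_treated nc W c t)
      = 1 / real n * (\<Sum>k=1..nc c. y k c s - y k c t) + D c (W c)" if c: "c \<in> {1..b}" for c
    proof -
      interpret balanced_block r "nc c" by (rule block[OF c])
      have Wc: "W c \<in> balanced_assignments r (nc c)"
        using W c by (auto simp: balanced_block_randomization_def set_Pi_pmf PiE_dflt_def set_p)
      have share: "y k c x * treat W k c x / num_treated nc W c x = y k c x * share (nc c) x k (W c)" for k x
        by (simp add: treat_def num_treated_def share_def group_size_def sum.If_cases Int_def)
      \<comment> \<open>Since the shares sum to 1, centring the outcomes shifts the group mean by
        exactly the block mean.\<close>
      have "(\<Sum>k=1..nc c. (y k c x - block_mean nc y c x) * share (nc c) x k (W c))
          = (\<Sum>k=1..nc c. y k c x * share (nc c) x k (W c)) - block_mean nc y c x"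
        if "x \<in> {1..r}" for x
        using sum_share[OF group_size_pos[OF Wc that]]
        by (simp add: left_diff_distrib sum_subtractf flip: sum_distrib_left)
      then have D_eq: "D c (W c) = real (nc c) / real n *
          (((\<Sum>k=1..nc c. y k c s * share (nc c) s k (W c)) - block_mean nc y c s)
            - ((\<Sum>k=1..nc c. y k c t * share (nc c) t k (W c)) - block_mean nc y c t))"
        unfolding D_def using assms(4,5) by simp
      \<comment> \<open>The block means, weighted by the relative block size, cancel against the
        block's part of \<open>sate\<close>.\<close>
      show ?thesis
        unfolding D_eq share sum_subtractf block_mean_def using m_gt_1
        by (simp add: right_diff_distrib)
    qed
    then show ?thesis
      unfolding diff_estimator_def sate_def sum_distrib_left[of "1 / real n"] sum.distrib[symmetric]
      by (intro sum.cong refl) (simp add: sum_distrib_left[of "1 / real n"])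
  qed
  have int: "integrable (measure_pmf ?P) h" for h :: "_ \<Rightarrow> real"
    unfolding balanced_block_randomization_def
    by (rule integrable_Pi_pmf_finite) (simp_all add: set_p fin)
  have mean: "measure_pmf.expectation ?P (diff_estimator n b nc y s t) = sate n b nc y s t"
  proof -
    have "measure_pmf.expectation ?P (diff_estimator n b nc y s t)
        = measure_pmf.expectation ?P (\<lambda>W. sate n b nc y s t + (\<Sum>c=1..b. D c (W c)))"
      by (intro integral_cong_AE) (auto simp: AE_measure_pmf_iff decomp)
    also have "\<dots> = sate n b nc y s t + (\<Sum>c=1..b. measure_pmf.expectation ?P (\<lambda>W. D c (W c)))"
      by (simp add: Bochner_Integration.integral_add Bochner_Integration.integral_sum int)
    also have "(\<Sum>c=1..b. measure_pmf.expectation ?P (\<lambda>W. D c (W c))) = 0"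
      unfolding balanced_block_randomization_def
      by (intro sum.neutral ballI) (simp add: expectation_Pi_pmf_component mean_D)
    finally show ?thesis
      by simp
  qed
  \<comment> \<open>By \<open>mean\<close> the variance is taken around \<open>sate\<close>, so
    \<open>decomp\<close> turns it into the second moment of the sum of the
    \<open>D c\<close>.\<close>
  moreover have "measure_pmf.variance ?P (diff_estimator n b nc y s t)
      = measure_pmf.expectation ?P (\<lambda>W. (\<Sum>c=1..b. D c (W c))\<^sup>2)"
    unfolding mean by (intro integral_cong_AE) (auto simp: AE_measure_pmf_iff decomp)
  moreover have "\<dots> = (\<Sum>c=1..b. measure_pmf.expectation (?p c) (\<lambda>f. (D c f)\<^sup>2))"
    unfolding balanced_block_randomization_def
    by (rule Pi_pmf_second_moment_sum) (simp_all add: set_p fin mean_D)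
  ultimately show ?thesis
    by (simp only: var_D sum.distrib[symmetric] cong: sum.cong)
qed

end
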